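(* Let $X,Y$ be real vector spaces, let $F\colon X\rightrightarrows Y$ be a convex set-valued mapping, and let $\mathrm{core}(\mathrm{gph}\,F)\neq\emptyset$. Then $$\mathrm{core}(\mathrm{gph}\,F)=\big\{(x,y)\in X\times Y\ \big|\ x\in\mathrm{core}(\mathrm{dom}\,F),\ y\in\mathrm{core}(F(x))\big\}.$$
   Context: All vector spaces are real and carry no topology. For a subset $\Omega$ of a vector space $Z$, the algebraic core is $\mathrm{core}(\Omega):=\{x\in\Omega\mid \forall v\in Z\ \exists\delta>0\ \forall t\in\mathbb{R}\text{ with }|t|<\delta:\ x+tv\in\Omega\}$. A set-valued mapping $F\colon X\rightrightarrows Y$ assigns to each $x\in X$ a (possibly empty) set $F(x)\subset Y$; $\mathrm{dom}(F):=\{x\in X\mid F(x)\neq\emptyset\}$ and $\mathrm{gph}(F):=\{(x,y)\in X\times Y\mid y\in F(x)\}$. $F$ is called convex if $\mathrm{gph}(F)$ is a convex subset of $X\times Y$. Cores of $\mathrm{gph}\,F$, $\mathrm{dom}\,F$, $F(x)$ are taken in $X\times Y$, $X$, $Y$, respectively. *)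

theory Defs
  imports "HOL-Analysis.Analysis"
begin

definition alg_core :: "'a::real_vector set \<Rightarrow> 'a set" where
  "alg_core \<Omega> = {x \<in> \<Omega>. \<forall>v. \<exists>\<delta>>0. \<forall>t::real. \<bar>t\<bar> < \<delta> \<longrightarrow> x + t *\<^sub>R v \<in> \<Omega>}"

text \<open>A set-valued mapping from \<open>X\<close> to \<open>Y\<close> is a total function into \<open>Y set\<close>; empty values are allowed.\<close>

definition sv_dom :: "('a \<Rightarrow> 'b set) \<Rightarrow> 'a set" where
  "sv_dom F = {x. F x \<noteq> {}}"

definition sv_gph :: "('a \<Rightarrow> 'b set) \<Rightarrow> ('a \<times> 'b) set" where
  "sv_gph F = {(x, y). y \<in> F x}"

definition sv_convex :: "('a::real_vector \<Rightarrow> 'b::real_vector set) \<Rightarrow> bool" where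
  "sv_convex F \<longleftrightarrow> convex (sv_gph F)"

end

(* Core points of a convex set are absorbing for convex combinations with positive weight. Starting
   from one core point (x0, y0) of the graph, extend the segment from x0 slightly beyond x inside
   the domain to obtain a core point (x, z) above x; then extend the segment from z slightly
   beyond y inside F x to see that (x, y) is a core point too. *)
theory Submission
  imports Defs
begin

lemma alg_coreD:
  assumes "x \<in> alg_core S"
  obtains \<delta> where "\<delta> > 0" "\<And>t. \<bar>t\<bar> < \<delta> \<Longrightarrow> x + t *\<^sub>R v \<in> S"
  using assms unfolding alg_core_def by blast

lemma alg_core_extend:
  assumes "x \<in> alg_core S"
  obtains t where "t > 0" "x + t *\<^sub>R (x - a) \<in> S"
proof -
  obtain \<delta> where "\<delta> > 0" "\<And>t. \<bar>t\<bar> < \<delta> \<Longrightarrow> x + t *\<^sub>R (x - a) \<in> S"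
    using alg_coreD[OF assms] by blast
  then show thesis
    using that[of "\<delta> / 2"] by simp
qed

text \<open>The map \<open>c \<mapsto> u *\<^sub>R c + (1 - u) *\<^sub>R b\<close> sends
  \<open>S\<close> into itself by convexity and scales every direction by \<open>u\<close>. A radius
  \<open>\<delta>\<close> that works at \<open>a\<close> in direction \<open>v\<close> therefore
  gives the radius \<open>u * \<delta>\<close> at the combination.\<close>

lemma convex_combination_in_alg_core:
  assumes S: "convex S" and a: "a \<in> alg_core S" and b: "b \<in> S" and u: "0 < u" "u \<le> 1"
  shows "u *\<^sub>R a + (1 - u) *\<^sub>R b \<in> alg_core S"
proof -
  have comb: "u *\<^sub>R c + (1 - u) *\<^sub>R b \<in> S" if "c \<in> S" for c
    using convexD[OF S that b, of u "1 - u"] u by simp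
  have "\<exists>\<delta>>0. \<forall>t. \<bar>t\<bar> < \<delta> \<longrightarrow> u *\<^sub>R a + (1 - u) *\<^sub>R b + t *\<^sub>R v \<in> S" for v
  proof -
    obtain \<delta> where \<delta>: "\<delta> > 0" "\<And>t. \<bar>t\<bar> < \<delta> \<Longrightarrow> a + t *\<^sub>R v \<in> S"
      using alg_coreD[OF a] by blast
    have "u *\<^sub>R a + (1 - u) *\<^sub>R b + t *\<^sub>R v \<in> S" if "\<bar>t\<bar> < u * \<delta>" for t
    proof -
      \<comment> \<open>A step \<open>t\<close> at the combination is the image of a step
        \<open>t / u\<close> at \<open>a\<close>.\<close>
      have "\<bar>t / u\<bar> < \<delta>"
        using that u by (simp add: abs_divide pos_divide_less_eq mult.commute)
      from comb[OF \<delta>(2)[OF this]] show ?thesis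
        using u by (simp add: scaleR_add_right algebra_simps)
    qed
    then show ?thesis
      using \<delta>(1) u by (intro exI[of _ "u * \<delta>"]) simp
  qed
  moreover have "a \<in> S"
    using a by (simp add: alg_core_def)
  ultimately show ?thesis
    using comb by (simp add: alg_core_def)
qed

text \<open>Recovers \<open>x\<close> from \<open>a\<close> and the prolonged endpoint. The weight
  of \<open>a\<close> lies strictly between 0 and 1, so \<open>a\<close> can serve as the core point
  in \<open>convex_combination_in_alg_core\<close>.\<close>

lemma convex_combination_of_extension:
  fixes a x :: "'a::real_vector"
  assumes "t > 0"
  shows "(t / (1 + t)) *\<^sub>R a + (1 - t / (1 + t)) *\<^sub>R (x + t *\<^sub>R (x - a)) = x"
proof -
  have w: "1 - t / (1 + t) = 1 / (1 + t)"
    using assms by (simp add: field_simps)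
  have "(t / (1 + t)) *\<^sub>R a + (1 - t / (1 + t)) *\<^sub>R (x + t *\<^sub>R (x - a))
      = (1 / (1 + t)) *\<^sub>R (t *\<^sub>R a + (x + t *\<^sub>R (x - a)))"
    unfolding w by (simp add: scaleR_add_right)
  also have "t *\<^sub>R a + (x + t *\<^sub>R (x - a)) = (1 + t) *\<^sub>R x"
    by (simp add: algebra_simps)
  finally show ?thesis
    using assms by simp
qed

lemma alg_core_gph_subset:
  "alg_core (sv_gph F) \<subseteq> {(x, y). x \<in> alg_core (sv_dom F) \<and> y \<in> alg_core (F x)}"
proof clarify
  fix x y assume xy: "(x, y) \<in> alg_core (sv_gph F)"
  then have y: "y \<in> F x"
    by (simp add: alg_core_def sv_gph_def)
  have "\<exists>\<delta>>0. \<forall>t. \<bar>t\<bar> < \<delta> \<longrightarrow> x + t *\<^sub>R v \<in> sv_dom F" for v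
  proof -
    \<comment> \<open>In a horizontal direction the same \<open>y\<close> stays a value of
      \<open>F\<close>, which witnesses nonemptiness.\<close>
    obtain \<delta> where \<delta>: "\<delta> > 0" "\<And>t. \<bar>t\<bar> < \<delta> \<Longrightarrow> (x, y) + t *\<^sub>R (v, 0) \<in> sv_gph F"
      using alg_coreD[OF xy] by blast
    have "x + t *\<^sub>R v \<in> sv_dom F" if "\<bar>t\<bar> < \<delta>" for t
      using \<delta>(2)[OF that] by (auto simp: sv_gph_def sv_dom_def)
    then show ?thesis
      using \<delta>(1) by blast
  qed
  moreover have "\<exists>\<delta>>0. \<forall>t. \<bar>t\<bar> < \<delta> \<longrightarrow> y + t *\<^sub>R v \<in> F x" for v
  proof -
    \<comment> \<open>A vertical direction stays in the fibre over \<open>x\<close>.\<close>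
    obtain \<delta> where \<delta>: "\<delta> > 0" "\<And>t. \<bar>t\<bar> < \<delta> \<Longrightarrow> (x, y) + t *\<^sub>R (0, v) \<in> sv_gph F"
      using alg_coreD[OF xy] by blast
    have "y + t *\<^sub>R v \<in> F x" if "\<bar>t\<bar> < \<delta>" for t
      using \<delta>(2)[OF that] by (simp add: sv_gph_def)
    then show ?thesis
      using \<delta>(1) by blast
  qed
  ultimately show "x \<in> alg_core (sv_dom F) \<and> y \<in> alg_core (F x)"
    using y by (auto simp: alg_core_def sv_dom_def)
qed

theorem theorem4p2:
  fixes F :: "'a::real_vector \<Rightarrow> 'b::real_vector set"
  assumes "sv_convex F"
    and "alg_core (sv_gph F) \<noteq> {}"
  shows "alg_core (sv_gph F) = {(x, y). x \<in> alg_core (sv_dom F) \<and> y \<in> alg_core (F x)}"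
proof (rule antisym[OF alg_core_gph_subset], clarify)
  fix x y assume x: "x \<in> alg_core (sv_dom F)" and y: "y \<in> alg_core (F x)"
  have conv: "convex (sv_gph F)"
    using assms(1) by (simp add: sv_convex_def)
  obtain x0 y0 where core0: "(x0, y0) \<in> alg_core (sv_gph F)"
    using assms(2) by auto
  obtain t where t: "t > 0" "x + t *\<^sub>R (x - x0) \<in> sv_dom F"
    using alg_core_extend[OF x] .
  then obtain y1 where "(x + t *\<^sub>R (x - x0), y1) \<in> sv_gph F"
    by (auto simp: sv_dom_def sv_gph_def)
  \<comment> \<open>The weight is chosen to make the first component exactly \<open>x\<close>; the
    second component is whatever results from \<open>y0\<close> and \<open>y1\<close>, and it
    becomes \<open>z\<close>.\<close>
  from convex_combination_in_alg_core[OF conv core0 this, of "t / (1 + t)"]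
  obtain z where z: "(x, z) \<in> alg_core (sv_gph F)"
    using t(1) convex_combination_of_extension[OF t(1), of x0 x] by auto
  obtain s where s: "s > 0" "y + s *\<^sub>R (y - z) \<in> F x"
    using alg_core_extend[OF y] .
  \<comment> \<open>The difference is \<open>(0, y - z)\<close>, so prolonging in the graph amounts
    to prolonging inside \<open>F x\<close>.\<close>
  then have "(x, y) + s *\<^sub>R ((x, y) - (x, z)) \<in> sv_gph F"
    by (simp add: sv_gph_def)
  from convex_combination_in_alg_core[OF conv z this, of "s / (1 + s)"]
  show "(x, y) \<in> alg_core (sv_gph F)"
    unfolding convex_combination_of_extension[OF s(1)] using s(1) by simp
qed

end
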